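(* For any $R>0$ we have $$\delta_R(E_1)\subset B_R\subset\delta_R(E_2),$$ where $B_R=\{g\in G\mid d(\mathrm{Id},g)\le R\}$ is the closed sub-Riemannian ball in the Heisenberg group and $$E_1=\{(x,y,z)\mid x^2+y^2+16\pi^2z^2\le1\},\qquad E_2=\{(x,y,z)\mid x^2+y^2+12z^2\le1\}.$$
   Context: $G\cong\mathbb R^3_{x,y,z}$ is the Heisenberg group with product $(x,y,z)\cdot(\bar x,\bar y,\bar z)=(x+\bar x,\ y+\bar y,\ z+\bar z+\frac12(x\bar y-y\bar x))$ and identity $\mathrm{Id}=(0,0,0)$. $d$ is the left-invariant sub-Riemannian (Carnot–Carathéodory) distance for which the fields $X_1=\partial_x-\frac y2\partial_z$, $X_2=\partial_y+\frac x2\partial_z$ form an orthonormal frame: $d(g_0,g_1)$ is the infimum of $\int_0^{t_1}(u_1^2+u_2^2)^{1/2}dt$ over Lipschitz curves with $\dot g=u_1X_1(g)+u_2X_2(g)$ a.e. joining $g_0$ to $g_1$. Dilations: $\delta_k(x,y,z)=(kx,ky,k^2z)$, $k>0$. *)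

theory Defs
  imports "HOL-Analysis.Analysis"
begin

type_synonym heis = "real \<times> real \<times> real"

definition heis_mult :: "heis \<Rightarrow> heis \<Rightarrow> heis" where
  "heis_mult = (\<lambda>(x, y, z) (x', y', z').
     (x + x', y + y', z + z' + (x * y' - y * x') / 2))"

definition heis_id :: heis where
  "heis_id = (0, 0, 0)"

definition heis_dilation :: "real \<Rightarrow> heis \<Rightarrow> heis" where
  "heis_dilation k = (\<lambda>(x, y, z). (k * x, k * y, k\<^sup>2 * z))"

text \<open>
  Vector fields are given by their coordinates in the basis
  \<open>\<partial>\<^sub>x\<close>, \<open>\<partial>\<^sub>y\<close>, \<open>\<partial>\<^sub>z\<close>.
\<close>

definition heis_X1 :: "heis \<Rightarrow> heis" where
  "heis_X1 = (\<lambda>(x, y, z). (1, 0, - y / 2))"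

definition heis_X2 :: "heis \<Rightarrow> heis" where
  "heis_X2 = (\<lambda>(x, y, z). (0, 1, x / 2))"

text \<open>
  Both fields are left-invariant: their value at \<open>g\<close> is the image of
  \<open>\<partial>\<^sub>x\<close>, respectively \<open>\<partial>\<^sub>y\<close>, at the identity under the differential of
  left translation by \<open>g\<close>.
\<close>

lemma heis_X1_left_translate:
  "((\<lambda>s. heis_mult g (s, 0, 0)) has_vector_derivative heis_X1 g) (at 0)"
  by (cases g) (auto simp: heis_mult_def heis_X1_def intro!: derivative_eq_intros
      has_vector_derivative_Pair simp flip: has_real_derivative_iff_has_vector_derivative)

lemma heis_X2_left_translate:
  "((\<lambda>s. heis_mult g (0, s, 0)) has_vector_derivative heis_X2 g) (at 0)"
  by (cases g) (auto simp: heis_mult_def heis_X2_def intro!: derivative_eq_intros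
      has_vector_derivative_Pair simp flip: has_real_derivative_iff_has_vector_derivative)

text \<open>
  A Lipschitz curve on \<open>[0, T]\<close> with measurable controls \<open>u\<^sub>1\<close>, \<open>u\<^sub>2\<close>. The controls
  agree almost everywhere with the first two components of the derivative of the curve, so
  they are essentially bounded and the length below is a genuine integral. Values outside
  \<open>[0, T]\<close> play no role, hence the one-sided derivative.
\<close>

definition horizontal_curve ::
    "real \<Rightarrow> (real \<Rightarrow> heis) \<Rightarrow> (real \<Rightarrow> real) \<Rightarrow> (real \<Rightarrow> real) \<Rightarrow> bool" where
  "horizontal_curve T \<gamma> u1 u2 \<longleftrightarrow>
     0 \<le> T \<and>
     (\<exists>L. lipschitz_on L {0..T} \<gamma>) \<and>
     u1 \<in> borel_measurable (lebesgue_on {0..T}) \<and>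
     u2 \<in> borel_measurable (lebesgue_on {0..T}) \<and>
     (AE t in lebesgue_on {0..T}.
        (\<gamma> has_vector_derivative (u1 t *\<^sub>R heis_X1 (\<gamma> t) + u2 t *\<^sub>R heis_X2 (\<gamma> t)))
          (at t within {0..T}))"

definition control_length :: "real \<Rightarrow> (real \<Rightarrow> real) \<Rightarrow> (real \<Rightarrow> real) \<Rightarrow> real" where
  "control_length T u1 u2 = (LINT t|lebesgue_on {0..T}. sqrt ((u1 t)\<^sup>2 + (u2 t)\<^sup>2))"

text \<open>
  The infimum is taken in the extended reals, so that a pair of points joined by no
  horizontal curve would be at distance \<open>\<infinity>\<close>.
\<close>

definition heis_dist :: "heis \<Rightarrow> heis \<Rightarrow> ereal" where
  "heis_dist g0 g1 = Inf {ereal (control_length T u1 u2) | T \<gamma> u1 u2.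
     horizontal_curve T \<gamma> u1 u2 \<and> \<gamma> 0 = g0 \<and> \<gamma> T = g1}"

definition heis_ball :: "real \<Rightarrow> heis set" where
  "heis_ball R = {g. heis_dist heis_id g \<le> ereal R}"

definition E1 :: "heis set" where
  "E1 = {(x, y, z). x\<^sup>2 + y\<^sup>2 + 16 * pi\<^sup>2 * z\<^sup>2 \<le> 1}"

definition E2 :: "heis set" where
  "E2 = {(x, y, z). x\<^sup>2 + y\<^sup>2 + 12 * z\<^sup>2 \<le> 1}"

end

theory Submission
  imports Defs
begin

text \<open>
  A horizontal curve from the identity is a plane curve together with the signed area that it
  sweeps out, and its length is the length of the plane curve. Both inclusions follow from this
  picture without determining the geodesics.

  \<^item> \<^emph>\<open>The outer ellipsoid.\<close> The sets \<open>\<delta>\<^sub>R(E\<^sub>2)\<close> are the sublevel sets of the homogeneous gauge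
    \<open>N\<close> with \<open>2 N\<^sup>2 = r\<^sup>2 + sqrt (r\<^sup>4 + 48 z\<^sup>2)\<close>, where \<open>r\<^sup>2 = x\<^sup>2 + y\<^sup>2\<close>. The horizontal gradient
    of \<open>N\<close> has norm at most one; after clearing denominators this is the inequality
    \<open>(N\<^sup>2 - r\<^sup>2)\<^sup>2 \<ge> 0\<close>. Hence \<open>N\<close> grows along a horizontal curve no faster than its length, so
    \<open>N(g) \<le> d(Id, g)\<close>. As \<open>N\<close> is not smooth at the identity, the argument
    (\<open>reg_gauge_le_control_length\<close>) is run for a smooth regularisation, and the
    regularisation parameter tends to zero at the end (\<open>heis_ball_subset_dilation_E2\<close>). The
    curves are only Lipschitz, which calls for the fundamental theorem of calculus in the form
    \<open>lipschitz_has_integral_derivative\<close>.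

  \<^item> \<^emph>\<open>The inner ellipsoid.\<close> Every point off the plane \<open>z = 0\<close> is reached by a circular arc
    (\<open>arc_half_angle_exists\<close>), and the points in that plane by straight segments. The arc with
    half-angle \<open>p\<close> and length one ends at a point with \<open>r = sin p / p\<close> and
    \<open>\<bar>z\<bar> = (p - sin p cos p) / (4 p\<^sup>2)\<close>, which is outside the interior of \<open>E\<^sub>1\<close> by the one-variable
    inequality \<open>arc_profile_inequality\<close>. By homogeneity, an arc ending in \<open>\<delta>\<^sub>R(E\<^sub>1)\<close> has length
    at most \<open>R\<close>.
\<close>

section \<open>Integrating the derivative of a Lipschitz function\<close>

lemma difference_quotient_sequence:
  fixes f :: "real \<Rightarrow> 'a::real_normed_vector"
  assumes "(f has_vector_derivative D) (at t within {a..b})" "a \<le> t" "t < b"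
  shows "(\<lambda>n. real (Suc n) *\<^sub>R (f (t + 1 / real (Suc n)) - f t)) \<longlonglongrightarrow> D"
proof -
  let ?h = "\<lambda>n. t + 1 / real (Suc n)"
  have "((\<lambda>s. (f s - f t - (s - t) *\<^sub>R D) /\<^sub>R norm (s - t)) \<longlongrightarrow> 0) (at t within {a..b})"
    using assms(1) unfolding has_vector_derivative_def has_derivative_within
    by (simp add: diff_diff_eq inverse_eq_divide)
  moreover have "filterlim ?h (at t within {a..b}) sequentially"
  proof -
    have "\<forall>\<^sub>F n in sequentially. 1 / real (Suc n) < b - t"
      using assms LIMSEQ_inverse_real_of_nat[unfolded inverse_eq_divide]
      by (intro order_tendstoD) auto
    then have "\<forall>\<^sub>F n in sequentially. ?h n \<in> {a..b} \<and> ?h n \<noteq> t"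
      by (rule eventually_mono) (use assms in \<open>auto intro: add_increasing2\<close>)
    moreover have "?h \<longlonglongrightarrow> t"
      using tendsto_add[OF tendsto_const LIMSEQ_inverse_real_of_nat[unfolded inverse_eq_divide], of t] by simp
    ultimately show ?thesis
      by (auto simp: filterlim_at eventually_conj_iff)
  qed
  ultimately have "(\<lambda>n. (f (?h n) - f t - (?h n - t) *\<^sub>R D) /\<^sub>R norm (?h n - t)) \<longlonglongrightarrow> 0"
    by (rule filterlim_compose)
  then have "(\<lambda>n. real (Suc n) *\<^sub>R (f (?h n) - f t) - D) \<longlonglongrightarrow> 0"
    by (simp add: scaleR_diff_right)
  then show ?thesis
    by (simp add: LIM_zero_iff)
qed

lemma lipschitz_difference_quotient_le:
  fixes f :: "real \<Rightarrow> 'a::real_normed_vector"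
  assumes "L-lipschitz_on X f" "t \<in> X" "t + 1 / real (Suc n) \<in> X"
  shows "norm (real (Suc n) *\<^sub>R (f (t + 1 / real (Suc n)) - f t)) \<le> L"
proof -
  have "norm (f (t + 1 / real (Suc n)) - f t) \<le> L * norm (t + 1 / real (Suc n) - t)"
    using assms by (intro lipschitz_on_normD)
  then have "real (Suc n) * norm (f (t + 1 / real (Suc n)) - f t) \<le> L"
    by (simp add: pos_le_divide_eq mult.commute)
  then show ?thesis by simp
qed

text \<open>
  A Lipschitz function is the integral of its almost everywhere derivative. The difference
  quotients \<open>n (f (t + 1/n) - f t)\<close> are bounded by the Lipschitz constant and converge to the
  derivative off a null set, so dominated convergence applies; by translation their integral is
  \<open>n\<close> times the integral of \<open>f\<close> over an interval of length \<open>1/n\<close> at the right end minus the same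
  at the left end, and this tends to \<open>f b - f a\<close> by continuity.
\<close>

lemma lipschitz_has_integral_derivative:
  fixes f :: "real \<Rightarrow> 'a::euclidean_space"
  assumes lip: "L-lipschitz_on {a..b} f" and "a \<le> b" and N: "negligible N"
    and deriv: "\<And>t. t \<in> {a..b} - N \<Longrightarrow> (f has_vector_derivative f' t) (at t within {a..b})"
  shows "(f' has_integral (f b - f a)) {a..b}"
proof -
  \<comment> \<open>Extending by a constant lets the quotients reach past \<open>b\<close>; the point \<open>b\<close> itself joins the null set.\<close>
  define F where "F t = f (min t b)" for t
  define G where "G u = integral {a..u} F" for u
  define q where "q n t = real (Suc n) *\<^sub>R (F (t + 1 / real (Suc n)) - F t)" for n t
  define M where "M = insert b N"
  have M: "negligible M"
    using N by (simp add: M_def)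
  have F_lip: "L-lipschitz_on {a..} F"
  proof (rule lipschitz_onI)
    fix s t assume "s \<in> {a..}" "t \<in> {a..}"
    then have "dist (F s) (F t) \<le> L * dist (min s b) (min t b)"
      unfolding F_def using \<open>a \<le> b\<close> by (intro lipschitz_onD[OF lip]) auto
    also have "\<dots> \<le> L * dist s t"
      by (intro mult_left_mono lipschitz_on_nonneg[OF lip]) (auto simp: dist_real_def)
    finally show "dist (F s) (F t) \<le> L * dist s t" .
  qed (rule lipschitz_on_nonneg[OF lip])
  have F_cont: "continuous_on {c..d} F" if "a \<le> c" for c d
    using that lipschitz_on_continuous_on[OF F_lip] by (auto intro: continuous_on_subset)
  have F_int: "F integrable_on {c..d}" if "a \<le> c" for c d
    using F_cont[OF that] by (rule integrable_continuous_real)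
  have G: "(G has_vector_derivative F u) (at u within {a..b+1})" if "u \<in> {a..b+1}" for u
    unfolding G_def by (intro integral_has_vector_derivative F_cont that) simp
  have q_int: "(q n has_integral real (Suc n) *\<^sub>R
      ((G (b + 1 / real (Suc n)) - G b) - (G (a + 1 / real (Suc n)) - G a))) {a..b}" for n
  proof -
    let ?h = "1 / real (Suc n)"
    have GF: "(F has_integral (G d - G c)) {c..d}" if "a \<le> c" "c \<le> d" for c d
    proof -
      have "G c + integral {c..d} F = G d"
        unfolding G_def using that by (intro Henstock_Kurzweil_Integration.integral_combine F_int) auto
      then show ?thesis
        using F_int[OF that(1), of d] by (metis add_diff_cancel_left' integrable_integral)
    qed
    have "((F \<circ> ((+) ?h)) has_integral (G (b + ?h) - G (a + ?h))) {a..b}"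
      unfolding has_integral_shift_Icc_real using \<open>a \<le> b\<close> by (intro GF) auto
    then have "((\<lambda>t. F (t + ?h)) has_integral (G (b + ?h) - G (a + ?h))) {a..b}"
      by (simp add: o_def add.commute)
    from has_integral_cmul[OF has_integral_diff[OF this GF[OF order_refl \<open>a \<le> b\<close>]], of "real (Suc n)"]
    show ?thesis
      unfolding q_def by (simp add: algebra_simps)
  qed
  have q_lim: "(\<lambda>n. q n t) \<longlonglongrightarrow> f' t" if "t \<in> {a..b} - M" for t
  proof -
    have t: "a \<le> t" "t < b" "t \<notin> N" using that by (auto simp: M_def)
    have "(\<lambda>n. real (Suc n) *\<^sub>R (f (t + 1 / real (Suc n)) - f t)) \<longlonglongrightarrow> f' t"
      using t by (intro difference_quotient_sequence[OF deriv]) auto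
    moreover have "\<forall>\<^sub>F n in sequentially. 1 / real (Suc n) < b - t"
      using t LIMSEQ_inverse_real_of_nat[unfolded inverse_eq_divide]
      by (intro order_tendstoD) auto
    then have "\<forall>\<^sub>F n in sequentially. real (Suc n) *\<^sub>R (f (t + 1 / real (Suc n)) - f t) = q n t"
      by (rule eventually_mono) (use t in \<open>auto simp: q_def F_def min_def\<close>)
    ultimately show ?thesis by (rule Lim_transform_eventually)
  qed
  have q_bound: "norm (q n t) \<le> L" if "t \<in> {a..b}" for n t
    unfolding q_def using that
    by (intro lipschitz_difference_quotient_le[OF F_lip]) (auto intro: add_increasing2)
  have y_lim: "(\<lambda>n. real (Suc n) *\<^sub>R
      ((G (b + 1 / real (Suc n)) - G b) - (G (a + 1 / real (Suc n)) - G a))) \<longlonglongrightarrow> F b - F a"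
    unfolding scaleR_diff_right[of _ "_ - _" "_ - _"]
    by (intro tendsto_diff difference_quotient_sequence[OF G]) (use \<open>a \<le> b\<close> in auto)
  have "((\<lambda>t. if t \<in> M then 0 else f' t) has_integral (F b - F a)) {a..b}"
  proof (rule has_integral_dominated_convergence[OF _ _ _ _ y_lim])
    show "((\<lambda>t. if t \<in> M then 0 else q n t) has_integral real (Suc n) *\<^sub>R
      ((G (b + 1 / real (Suc n)) - G b) - (G (a + 1 / real (Suc n)) - G a))) {a..b}" for n
      by (rule has_integral_spike[OF M _ q_int]) auto
    show "(\<lambda>_. L) integrable_on {a..b}"
      by (rule integrable_const_ivl)
    show "\<forall>t\<in>{a..b}. norm (if t \<in> M then 0 else q n t) \<le> L" for n
      using q_bound lipschitz_on_nonneg[OF lip] by auto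
    show "\<forall>t\<in>{a..b}. (\<lambda>n. if t \<in> M then 0 else q n t) \<longlonglongrightarrow> (if t \<in> M then 0 else f' t)"
      using q_lim by auto
  qed
  then have "(f' has_integral (F b - F a)) {a..b}"
    by (rule has_integral_spike[OF M, rotated]) auto
  then show ?thesis
    using \<open>a \<le> b\<close> by (simp add: F_def)
qed

lemma lipschitz_norm_vector_derivative_le:
  fixes f :: "real \<Rightarrow> 'a::real_normed_vector"
  assumes lip: "L-lipschitz_on {a..b} f"
    and "(f has_vector_derivative D) (at t within {a..b})" "a \<le> t" "t < b"
  shows "norm D \<le> L"
proof (rule tendsto_upperbound[OF tendsto_norm[OF difference_quotient_sequence[OF assms(2-4)]]])
  have "\<forall>\<^sub>F n in sequentially. 1 / real (Suc n) < b - t"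
    using assms LIMSEQ_inverse_real_of_nat[unfolded inverse_eq_divide]
    by (intro order_tendstoD) auto
  then show "\<forall>\<^sub>F n in sequentially. norm (real (Suc n) *\<^sub>R (f (t + 1 / real (Suc n)) - f t)) \<le> L"
    by (rule eventually_mono, intro lipschitz_difference_quotient_le[OF lip])
      (use assms in \<open>auto intro: add_increasing2\<close>)
qed simp

section \<open>Growth along horizontal curves and the outer ellipsoid\<close>

lemma horizontal_curve_derivative_off_negligible:
  assumes "horizontal_curve T \<gamma> u1 u2"
  obtains N where "negligible N"
    "\<And>t. t \<in> {0..T} - N \<Longrightarrow>
      (\<gamma> has_vector_derivative (u1 t *\<^sub>R heis_X1 (\<gamma> t) + u2 t *\<^sub>R heis_X2 (\<gamma> t))) (at t within {0..T})"
proof -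
  have "AE t in lebesgue. t \<in> {0..T} \<longrightarrow>
      (\<gamma> has_vector_derivative (u1 t *\<^sub>R heis_X1 (\<gamma> t) + u2 t *\<^sub>R heis_X2 (\<gamma> t))) (at t within {0..T})"
    using assms by (simp add: horizontal_curve_def AE_restrict_space_iff)
  then show thesis
    by (elim AE_E) (rule that, auto simp: negligible_iff_null_sets null_sets_def)
qed

text \<open>
  The integral of a non-integrable function is zero by convention, so a length can only be
  compared with anything once this is known. The speed is the norm of the first two components
  of the velocity, which the Lipschitz constant of the curve bounds almost everywhere.
\<close>

lemma horizontal_speed_integrable:
  assumes "horizontal_curve T \<gamma> u1 u2"
  shows "integrable (lebesgue_on {0..T}) (\<lambda>t. sqrt ((u1 t)\<^sup>2 + (u2 t)\<^sup>2))"
proof -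
  obtain L where lip: "L-lipschitz_on {0..T} \<gamma>"
    and [measurable]: "u1 \<in> borel_measurable (lebesgue_on {0..T})" "u2 \<in> borel_measurable (lebesgue_on {0..T})"
    using assms by (auto simp: horizontal_curve_def)
  have bound: "sqrt ((u1 t)\<^sup>2 + (u2 t)\<^sup>2) \<le> L"
    if "(\<gamma> has_vector_derivative (u1 t *\<^sub>R heis_X1 (\<gamma> t) + u2 t *\<^sub>R heis_X2 (\<gamma> t))) (at t within {0..T})"
      "0 \<le> t" "t < T" for t
  proof -
    have "sqrt ((u1 t)\<^sup>2 + (u2 t)\<^sup>2) \<le> norm (u1 t *\<^sub>R heis_X1 (\<gamma> t) + u2 t *\<^sub>R heis_X2 (\<gamma> t))"
      by (cases "\<gamma> t") (simp add: heis_X1_def heis_X2_def norm_Pair)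
    also have "\<dots> \<le> L"
      using that by (rule lipschitz_norm_vector_derivative_le[OF lip])
    finally show ?thesis .
  qed
  obtain N where N: "negligible N" and \<gamma>': "\<And>t. t \<in> {0..T} - N \<Longrightarrow>
      (\<gamma> has_vector_derivative (u1 t *\<^sub>R heis_X1 (\<gamma> t) + u2 t *\<^sub>R heis_X2 (\<gamma> t))) (at t within {0..T})"
    using horizontal_curve_derivative_off_negligible[OF assms] by blast
  have "insert T N \<in> null_sets lebesgue"
    using N by (simp flip: negligible_iff_null_sets)
  then have "AE t in lebesgue. t \<in> {0..T} \<longrightarrow> norm (sqrt ((u1 t)\<^sup>2 + (u2 t)\<^sup>2)) \<le> L"
    by (rule AE_I') (use bound[OF \<gamma>'] in force)
  then have "AE t in lebesgue_on {0..T}. norm (sqrt ((u1 t)\<^sup>2 + (u2 t)\<^sup>2)) \<le> L"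
    by (simp add: AE_restrict_space_iff)
  moreover have "finite_measure (lebesgue_on {0..T})"
    by (intro finite_measure_lebesgue_on) auto
  ultimately show ?thesis
    by (intro finite_measure.integrable_const_bound[where B = L]) measurable
qed

text \<open>
  Why a function with small horizontal gradient bounds the distance from below: along a
  horizontal curve the derivative of \<open>F\<close> is \<open>u\<^sub>1 X\<^sub>1 F + u\<^sub>2 X\<^sub>2 F\<close>, which by the Cauchy-Schwarz
  inequality is at most the speed when the horizontal gradient of \<open>F\<close> has norm at most one.
  Continuity of the partial derivatives \<open>p\<close>, \<open>q\<close>, \<open>s\<close> makes \<open>F\<close> Lipschitz on a ball that
  contains the curve, so that the derivative can be integrated.
\<close>

lemma horizontal_gradient_bound:
  fixes F :: "heis \<Rightarrow> real"
  assumes deriv: "\<And>g. (F has_derivative (\<lambda>(a, b, c). p g * a + q g * b + s g * c)) (at g)"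
    and cont: "continuous_on UNIV p" "continuous_on UNIV q" "continuous_on UNIV s"
    and eik: "\<And>x y z. (p (x, y, z) - y / 2 * s (x, y, z))\<^sup>2 + (q (x, y, z) + x / 2 * s (x, y, z))\<^sup>2 \<le> 1"
    and curve: "horizontal_curve T \<gamma> u1 u2"
  shows "F (\<gamma> T) - F (\<gamma> 0) \<le> control_length T u1 u2"
proof -
  obtain L where lip: "L-lipschitz_on {0..T} \<gamma>" and T: "0 \<le> T"
    using curve by (auto simp: horizontal_curve_def)
  obtain N where N: "negligible N" and \<gamma>': "\<And>t. t \<in> {0..T} - N \<Longrightarrow>
      (\<gamma> has_vector_derivative (u1 t *\<^sub>R heis_X1 (\<gamma> t) + u2 t *\<^sub>R heis_X2 (\<gamma> t))) (at t within {0..T})"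
    using horizontal_curve_derivative_off_negligible[OF curve] by blast
  have "compact (\<gamma> ` {0..T})"
    by (intro compact_continuous_image lipschitz_on_continuous_on[OF lip] compact_Icc)
  then obtain B where B: "\<gamma> ` {0..T} \<subseteq> cball 0 B"
    using compact_imp_bounded[of "\<gamma> ` {0..T}"] by (force simp: bounded_iff)
  have "compact ((\<lambda>g. \<bar>p g\<bar> + \<bar>q g\<bar> + \<bar>s g\<bar>) ` cball 0 B)"
    by (intro compact_continuous_image continuous_intros compact_cball)
      (auto intro: continuous_on_subset[OF cont(1)] continuous_on_subset[OF cont(2)] continuous_on_subset[OF cont(3)])
  then have "bounded ((\<lambda>g. \<bar>p g\<bar> + \<bar>q g\<bar> + \<bar>s g\<bar>) ` cball 0 B)"
    by (rule compact_imp_bounded)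
  then obtain C where C: "0 < C" "\<And>g. g \<in> cball 0 B \<Longrightarrow> \<bar>p g\<bar> + \<bar>q g\<bar> + \<bar>s g\<bar> \<le> C"
    unfolding bounded_pos by force
  have "C-lipschitz_on (cball 0 B) F"
  proof (rule lipschitz_onI)
    fix g h :: heis assume gh: "g \<in> cball 0 B" "h \<in> cball 0 B"
    have "norm (F g - F h) \<le> C * norm (g - h)"
    proof (rule differentiable_bound[OF convex_cball _ _ gh])
      fix k :: heis assume k: "k \<in> cball 0 B"
      show "(F has_derivative (\<lambda>(a, b, c). p k * a + q k * b + s k * c)) (at k within cball 0 B)"
        by (rule has_derivative_at_withinI[OF deriv])
      show "onorm (\<lambda>(a, b, c). p k * a + q k * b + s k * c) \<le> C"
      proof (rule onorm_le)
        fix v :: heis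
        obtain a b c where v: "v = (a, b, c)" by (cases v)
        have abc: "\<bar>a\<bar> \<le> norm v" "\<bar>b\<bar> \<le> norm v" "\<bar>c\<bar> \<le> norm v"
          using norm_fst_le[of a "(b, c)"] norm_snd_le[of "(b, c)" a] norm_fst_le[of b c] norm_snd_le[of c b]
          by (auto simp: v)
        have "\<bar>p k * a + q k * b + s k * c\<bar> \<le> \<bar>p k\<bar> * \<bar>a\<bar> + \<bar>q k\<bar> * \<bar>b\<bar> + \<bar>s k\<bar> * \<bar>c\<bar>"
          by (simp flip: abs_mult)
        also have "\<dots> \<le> \<bar>p k\<bar> * norm v + \<bar>q k\<bar> * norm v + \<bar>s k\<bar> * norm v"
          using abc by (intro add_mono mult_left_mono) auto
        also have "\<dots> = (\<bar>p k\<bar> + \<bar>q k\<bar> + \<bar>s k\<bar>) * norm v"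
          by (simp add: algebra_simps)
        also have "\<dots> \<le> C * norm v"
          using C(2)[OF k] by (rule mult_right_mono) simp
        finally show "norm (case v of (a, b, c) \<Rightarrow> p k * a + q k * b + s k * c) \<le> C * norm v"
          by (simp add: v)
      qed
    qed
    then show "dist (F g) (F h) \<le> C * dist g h"
      by (simp add: dist_norm)
  qed (use C in simp)
  then have F_lip: "(C * L)-lipschitz_on {0..T} (F \<circ> \<gamma>)"
    using lip B by (intro lipschitz_on_compose) (auto intro: lipschitz_on_subset)
  define D where "D t = (case \<gamma> t of (x, y, z) \<Rightarrow>
      u1 t * (p (x, y, z) - y / 2 * s (x, y, z)) + u2 t * (q (x, y, z) + x / 2 * s (x, y, z)))" for t
  have "((F \<circ> \<gamma>) has_vector_derivative D t) (at t within {0..T})" if "t \<in> {0..T} - N" for t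
  proof -
    have "((F \<circ> \<gamma>) has_vector_derivative
        (case u1 t *\<^sub>R heis_X1 (\<gamma> t) + u2 t *\<^sub>R heis_X2 (\<gamma> t) of
          (a, b, c) \<Rightarrow> p (\<gamma> t) * a + q (\<gamma> t) * b + s (\<gamma> t) * c)) (at t within {0..T})"
      by (rule vector_derivative_diff_chain_within[OF \<gamma>'[OF that] has_derivative_at_withinI[OF deriv]])
    then show ?thesis
      by (cases "\<gamma> t") (simp add: D_def heis_X1_def heis_X2_def algebra_simps)
  qed
  then have "(D has_integral ((F \<circ> \<gamma>) T - (F \<circ> \<gamma>) 0)) {0..T}"
    by (rule lipschitz_has_integral_derivative[OF F_lip T N])
  moreover have "((\<lambda>t. sqrt ((u1 t)\<^sup>2 + (u2 t)\<^sup>2)) has_integral control_length T u1 u2) {0..T}"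
    unfolding control_length_def
    by (intro has_integral_integral_lebesgue_on horizontal_speed_integrable[OF curve]) auto
  moreover have "D t \<le> sqrt ((u1 t)\<^sup>2 + (u2 t)\<^sup>2)" for t
  proof -
    obtain x y z where g: "\<gamma> t = (x, y, z)" by (cases "\<gamma> t")
    let ?P = "p (x, y, z) - y / 2 * s (x, y, z)" and ?Q = "q (x, y, z) + x / 2 * s (x, y, z)"
    have "D t = (u1 t, u2 t) \<bullet> (?P, ?Q)"
      by (simp add: D_def g)
    also have "\<dots> \<le> norm (u1 t, u2 t) * norm (?P, ?Q)"
      by (rule norm_cauchy_schwarz)
    also have "\<dots> \<le> norm (u1 t, u2 t) * 1"
      using eik[of x y z] by (intro mult_left_mono) (auto simp: norm_Pair)
    finally show ?thesis by (simp add: norm_Pair)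
  qed
  ultimately have "(F \<circ> \<gamma>) T - (F \<circ> \<gamma>) 0 \<le> control_length T u1 u2"
    by (rule has_integral_le)
  then show ?thesis by simp
qed

text \<open>
  For \<open>e = 0\<close> this is the homogeneous gauge whose sublevel set at height \<open>R\<close> is the dilated
  ellipsoid: with \<open>r\<^sup>2 = x\<^sup>2 + y\<^sup>2\<close>, its square is the larger root \<open>m\<close> of
  \<open>m\<^sup>2 - r\<^sup>2 m - 12 z\<^sup>2 = 0\<close>. The gauge is not differentiable at the identity, where the curves
  start; a positive \<open>e\<close> makes it smooth everywhere without spoiling the gradient bound.
\<close>

definition reg_gauge :: "real \<Rightarrow> heis \<Rightarrow> real" where
  "reg_gauge e = (\<lambda>(x, y, z). sqrt ((x\<^sup>2 + y\<^sup>2 + sqrt ((x\<^sup>2 + y\<^sup>2)\<^sup>2 + 48 * z\<^sup>2 + e\<^sup>2)) / 2))"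

text \<open>
  The horizontal gradients of \<open>r\<^sup>2 = x\<^sup>2 + y\<^sup>2\<close> and of \<open>z\<close> are orthogonal, of squared norm
  \<open>4 r\<^sup>2\<close> and \<open>r\<^sup>2 / 4\<close>. With \<open>S = sqrt (r\<^sup>4 + 48 z\<^sup>2 + e\<^sup>2)\<close>, so that twice the squared gauge is
  \<open>r\<^sup>2 + S\<close>, the condition that the horizontal gradient has norm at most one then follows
  from \<open>(S - r\<^sup>2)\<^sup>2 \<ge> 0\<close>.
\<close>

lemma reg_gauge_le_control_length:
  assumes e: "e > 0" and curve: "horizontal_curve T \<gamma> u1 u2"
  shows "reg_gauge e (\<gamma> T) - reg_gauge e (\<gamma> 0) \<le> control_length T u1 u2"
proof -
  define S :: "heis \<Rightarrow> real" where "S = (\<lambda>(x, y, z). sqrt ((x\<^sup>2 + y\<^sup>2)\<^sup>2 + 48 * z\<^sup>2 + e\<^sup>2))"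
  define n where "n = reg_gauge e"
  have S_pos: "0 < S g" for g
    using e by (cases g) (auto simp: S_def intro!: add_nonneg_pos)
  have n_pos: "0 < n g" for g
    using S_pos[of g] by (cases g) (auto simp: n_def reg_gauge_def S_def intro!: add_nonneg_pos)
  have S_cont: "continuous_on UNIV S" and n_cont: "continuous_on UNIV n"
    unfolding S_def n_def reg_gauge_def case_prod_beta by (intro continuous_intros; simp)+
  \<comment> \<open>The three partial derivatives of the regularised gauge.\<close>
  define p where "p g = fst g * (1 + ((fst g)\<^sup>2 + (fst (snd g))\<^sup>2) / S g) / (2 * n g)" for g
  define q where "q g = fst (snd g) * (1 + ((fst g)\<^sup>2 + (fst (snd g))\<^sup>2) / S g) / (2 * n g)" for g
  define s where "s g = 12 * snd (snd g) / (S g * n g)" for g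
  have "n (\<gamma> T) - n (\<gamma> 0) \<le> control_length T u1 u2"
  proof (rule horizontal_gradient_bound[OF _ _ _ _ _ curve])
    show "continuous_on UNIV p" "continuous_on UNIV q" "continuous_on UNIV s"
      unfolding p_def q_def s_def using S_pos n_pos
      by (auto intro!: continuous_intros S_cont n_cont simp: less_imp_neq[THEN not_sym] order.strict_implies_not_eq)
    fix g :: heis
    obtain x y z where g: "g = (x, y, z)" by (cases g)
    have "0 < (x\<^sup>2 + y\<^sup>2)\<^sup>2 + 48 * z\<^sup>2 + e\<^sup>2"
      using e by (auto intro!: add_nonneg_pos)
    then have dS: "(S has_derivative
        (\<lambda>v. (2 * (x\<^sup>2 + y\<^sup>2) * (x * fst v + y * fst (snd v)) + 48 * z * snd (snd v)) / S g)) (at g)"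
      unfolding S_def g case_prod_beta by (auto intro!: derivative_eq_intros simp: field_simps)
    have n_eq: "n = (\<lambda>g. sqrt (1 / 2 * ((fst g)\<^sup>2 + (fst (snd g))\<^sup>2 + S g)))"
      by (auto simp: n_def reg_gauge_def S_def)
    have "((\<lambda>v. (fst v)\<^sup>2 + (fst (snd v))\<^sup>2) has_derivative
        (\<lambda>v. 2 * x * fst v + 2 * y * fst (snd v))) (at g)"
      by (auto intro!: derivative_eq_intros simp: g)
    then have "((\<lambda>v. 1 / 2 * ((fst v)\<^sup>2 + (fst (snd v))\<^sup>2 + S v)) has_derivative
        (\<lambda>v. 1 / 2 * (2 * x * fst v + 2 * y * fst (snd v) +
          (2 * (x\<^sup>2 + y\<^sup>2) * (x * fst v + y * fst (snd v)) + 48 * z * snd (snd v)) / S g))) (at g)"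
      by (rule has_derivative_mult_right[OF has_derivative_add[OF _ dS]])
    moreover have "0 < 1 / 2 * ((fst g)\<^sup>2 + (fst (snd g))\<^sup>2 + S g)"
      using S_pos[of g] by (auto intro!: add_nonneg_pos)
    ultimately have "(n has_derivative (\<lambda>v. 1 / 2 * (2 * x * fst v + 2 * y * fst (snd v) +
        (2 * (x\<^sup>2 + y\<^sup>2) * (x * fst v + y * fst (snd v)) + 48 * z * snd (snd v)) / S g) *
        (inverse (n g) / 2))) (at g)"
      unfolding n_eq by (rule has_derivative_real_sqrt[rotated])
    moreover have "1 / 2 * (2 * x * fst v + 2 * y * fst (snd v) +
        (2 * (x\<^sup>2 + y\<^sup>2) * (x * fst v + y * fst (snd v)) + 48 * z * snd (snd v)) / S g) *
        (inverse (n g) / 2) = (case v of (a, b, c) \<Rightarrow> p g * a + q g * b + s g * c)" for v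
      using S_pos[of g] n_pos[of g] by (cases v) (simp add: p_def q_def s_def g field_simps)
    ultimately show "(n has_derivative (\<lambda>(a, b, c). p g * a + q g * b + s g * c)) (at g)"
      by simp
  next
    fix x y z :: real
    \<comment> \<open>Here \<open>r\<close> is the square of the Euclidean distance to the vertical axis.\<close>
    define r where "r = x\<^sup>2 + y\<^sup>2"
    define S' where "S' = S (x, y, z)"
    define m where "m = n (x, y, z)"
    have pos: "0 \<le> r" "0 < S'" "0 < m"
      using S_pos n_pos by (auto simp: r_def S'_def m_def)
    have "S'\<^sup>2 = r\<^sup>2 + 48 * z\<^sup>2 + e\<^sup>2"
      by (simp add: S'_def S_def r_def)
    then have z: "48 * z\<^sup>2 \<le> (S' - r) * (S' + r)"
      by (simp add: algebra_simps power2_eq_square)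
    have m: "2 * m\<^sup>2 = r + S'"
      using pos by (simp add: m_def n_def reg_gauge_def S'_def S_def r_def)
    have "r * ((S' + r)\<^sup>2 + 144 * z\<^sup>2) \<le> r * ((S' + r)\<^sup>2 + 3 * ((S' - r) * (S' + r)))"
      using z pos by (intro mult_left_mono) auto
    also have "\<dots> = 2 * (S' + r) * S'\<^sup>2 - 2 * (S' + r) * (S' - r)\<^sup>2"
      by (simp add: algebra_simps power2_eq_square)
    also have "\<dots> \<le> 2 * (S' + r) * S'\<^sup>2"
      using pos by simp
    also have "\<dots> = (2 * S' * m)\<^sup>2"
      using m by (simp add: power_mult_distrib)
    finally have "r * ((S' + r)\<^sup>2 + 144 * z\<^sup>2) / (2 * S' * m)\<^sup>2 \<le> 1"
      using pos by (simp add: divide_le_eq)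
    moreover have "(p (x, y, z) - y / 2 * s (x, y, z))\<^sup>2 + (q (x, y, z) + x / 2 * s (x, y, z))\<^sup>2 =
        r * ((S' + r)\<^sup>2 + 144 * z\<^sup>2) / (2 * S' * m)\<^sup>2"
    proof -
      have "p (x, y, z) - y / 2 * s (x, y, z) = (x * (S' + r) - y * (12 * z)) / (2 * S' * m)"
        "q (x, y, z) + x / 2 * s (x, y, z) = (y * (S' + r) + x * (12 * z)) / (2 * S' * m)"
        using pos by (simp_all add: p_def q_def s_def field_simps flip: S'_def m_def r_def)
      moreover have "(x * (S' + r) - y * (12 * z))\<^sup>2 + (y * (S' + r) + x * (12 * z))\<^sup>2 =
          r * ((S' + r)\<^sup>2 + 144 * z\<^sup>2)"
        unfolding r_def by (simp add: power2_eq_square algebra_simps)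
      ultimately show ?thesis
        by (simp add: power_divide flip: add_divide_distrib)
    qed
    ultimately show "(p (x, y, z) - y / 2 * s (x, y, z))\<^sup>2 + (q (x, y, z) + x / 2 * s (x, y, z))\<^sup>2 \<le> 1"
      by simp
  qed
  then show ?thesis by (simp add: n_def)
qed

lemma reg_gauge_le_heis_dist:
  assumes "e > 0" "heis_dist heis_id g \<le> ereal R"
  shows "reg_gauge e g \<le> R + sqrt (e / 2)"
proof -
  have "reg_gauge e heis_id = sqrt (e / 2)"
    using assms by (simp add: reg_gauge_def heis_id_def)
  then have "ereal (reg_gauge e g - sqrt (e / 2)) \<le> heis_dist heis_id g"
    unfolding heis_dist_def
    by (intro Inf_greatest) (use reg_gauge_le_control_length[OF assms(1)] in force)
  also note assms(2)
  finally show ?thesis by simp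
qed

lemma heis_ball_subset_dilation_E2:
  assumes "R > 0"
  shows "heis_ball R \<subseteq> heis_dilation R ` E2"
proof
  fix g assume g: "g \<in> heis_ball R"
  obtain x y z where xyz: "g = (x, y, z)" by (cases g)
  have "((\<lambda>e. reg_gauge e g) \<longlongrightarrow> reg_gauge 0 g) (at_right 0)"
    unfolding reg_gauge_def xyz by (auto intro!: tendsto_eq_intros)
  moreover have "((\<lambda>e. R + sqrt (e / 2)) \<longlongrightarrow> R) (at_right 0)"
    by (auto intro!: tendsto_eq_intros)
  moreover have "\<forall>\<^sub>F e in at_right 0. reg_gauge e g \<le> R + sqrt (e / 2)"
    using g by (auto simp: eventually_at_right_less heis_ball_def
        intro!: eventually_at_rightI[of 0 1] reg_gauge_le_heis_dist)
  ultimately have "reg_gauge 0 g \<le> R"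
    by (intro tendsto_le[of "at_right 0"]) auto
  define r where "r = x\<^sup>2 + y\<^sup>2"
  have "sqrt ((r + sqrt (r\<^sup>2 + 48 * z\<^sup>2)) / 2) \<le> R"
    using \<open>reg_gauge 0 g \<le> R\<close> by (simp add: reg_gauge_def xyz r_def)
  then have "sqrt (r\<^sup>2 + 48 * z\<^sup>2) \<le> 2 * R\<^sup>2 - r"
    using assms by (auto simp: real_le_lsqrt dest: sqrt_le_D)
  then have "r\<^sup>2 + 48 * z\<^sup>2 \<le> (2 * R\<^sup>2 - r)\<^sup>2"
    by (rule sqrt_le_D)
  then have "R\<^sup>2 * r + 12 * z\<^sup>2 \<le> R ^ 4"
    by (simp add: power2_eq_square algebra_simps eval_nat_numeral)
  have "(x / R)\<^sup>2 + (y / R)\<^sup>2 + 12 * (z / R\<^sup>2)\<^sup>2 \<le> 1"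
  proof -
    have "(x / R)\<^sup>2 + (y / R)\<^sup>2 + 12 * (z / R\<^sup>2)\<^sup>2 = (R\<^sup>2 * r + 12 * z\<^sup>2) / R ^ 4"
      using assms by (simp add: r_def field_simps eval_nat_numeral)
    then show ?thesis
      using \<open>R\<^sup>2 * r + 12 * z\<^sup>2 \<le> R ^ 4\<close> assms by (simp add: divide_le_eq)
  qed
  then have "(x / R, y / R, z / R\<^sup>2) \<in> E2"
    by (simp add: E2_def)
  moreover have "g = heis_dilation R (x / R, y / R, z / R\<^sup>2)"
    using assms by (simp add: heis_dilation_def xyz)
  ultimately show "g \<in> heis_dilation R ` E2" by blast
qed

section \<open>Trigonometric inequalities for circular arcs\<close>

lemma mult_cos_le_sin:
  fixes p :: real
  assumes "0 \<le> p" "p \<le> pi"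
  shows "p * cos p \<le> sin p"
proof -
  have "(\<lambda>x. sin x - x * cos x) 0 \<le> (\<lambda>x. sin x - x * cos x) p"
  proof (rule DERIV_nonneg_imp_nondecreasing[OF assms(1)])
    fix x assume x: "0 \<le> x" "x \<le> p"
    have "((\<lambda>x. sin x - x * cos x) has_real_derivative x * sin x) (at x)"
      by (auto intro!: derivative_eq_intros simp: algebra_simps)
    moreover have "0 \<le> x * sin x"
      using x assms by (intro mult_nonneg_nonneg sin_ge_zero) auto
    ultimately show "\<exists>y. ((\<lambda>x. sin x - x * cos x) has_real_derivative y) (at x) \<and> 0 \<le> y"
      by blast
  qed
  then show ?thesis by simp
qed

text \<open>
  Jordan's inequality: \<open>sin x / x\<close> is decreasing on \<open>[0, pi/2]\<close> because the numerator
  \<open>x cos x - sin x\<close> of its derivative is not positive.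
\<close>

lemma sin_ge_chord:
  fixes x :: real
  assumes "0 \<le> x" "x \<le> pi / 2"
  shows "2 * x \<le> pi * sin x"
proof (cases "x = 0")
  case False
  then have "0 < x" using assms by simp
  have "sin (pi / 2) / (pi / 2) \<le> sin x / x"
  proof (rule DERIV_nonpos_imp_nonincreasing[OF assms(2)])
    fix y assume y: "x \<le> y" "y \<le> pi / 2"
    have "((\<lambda>y. sin y / y) has_real_derivative (y * cos y - sin y) / y\<^sup>2) (at y)"
      using y \<open>0 < x\<close> by (auto intro!: derivative_eq_intros simp: power2_eq_square mult.commute)
    moreover have "(y * cos y - sin y) / y\<^sup>2 \<le> 0"
      using y \<open>0 < x\<close> mult_cos_le_sin[of y] by (intro divide_nonpos_nonneg) auto
    ultimately show "\<exists>D. ((\<lambda>y. sin y / y) has_real_derivative D) (at y) \<and> D \<le> 0"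
      by blast
  qed
  then show ?thesis
    using \<open>0 < x\<close> by (simp add: field_simps)
qed simp

text \<open>
  The derivative of \<open>p - sin p cos p\<close> is \<open>2 sin\<^sup>2 p\<close>, and Jordan's inequality makes
  \<open>2 pi\<^sup>2 sin\<^sup>2 p\<close> at least \<open>8 p\<^sup>2\<close>; the left-hand side has derivative \<open>6 p\<^sup>2\<close>.
\<close>

lemma cube_le_self_minus_sin_cos:
  fixes p :: real
  assumes "0 \<le> p" "p \<le> pi / 2"
  shows "2 * p ^ 3 \<le> pi\<^sup>2 * (p - sin p * cos p)"
proof -
  let ?h = "\<lambda>x. pi\<^sup>2 * (x - sin x * cos x) - 2 * x ^ 3"
  have "?h 0 \<le> ?h p"
  proof (rule DERIV_nonneg_imp_nondecreasing[OF assms(1)])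
    fix x assume x: "0 \<le> x" "x \<le> p"
    have "(?h has_real_derivative pi\<^sup>2 * (1 - ((cos x)\<^sup>2 - (sin x)\<^sup>2)) - 6 * x\<^sup>2) (at x)"
      by (auto intro!: derivative_eq_intros simp: power2_eq_square)
    moreover have "1 - ((cos x)\<^sup>2 - (sin x)\<^sup>2) = 2 * (sin x)\<^sup>2"
      using sin_cos_squared_add[of x] by linarith
    moreover have "0 \<le> pi\<^sup>2 * (2 * (sin x)\<^sup>2) - 6 * x\<^sup>2"
    proof -
      have "(2 * x)\<^sup>2 \<le> (pi * sin x)\<^sup>2"
        using x assms by (intro power_mono sin_ge_chord) auto
      then have "4 * x\<^sup>2 \<le> pi\<^sup>2 * (sin x)\<^sup>2"
        by (simp add: power_mult_distrib)
      moreover have "0 \<le> x\<^sup>2" by simp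
      ultimately show ?thesis by linarith
    qed
    ultimately show "\<exists>y. (?h has_real_derivative y) (at x) \<and> 0 \<le> y"
      by auto
  qed
  then show ?thesis by simp
qed

text \<open>
  Dividing by \<open>p\<^sup>4\<close> gives \<open>(sin p / p)\<^sup>2 + 16 pi\<^sup>2 z\<^sup>2 \<ge> 1\<close> with
  \<open>z = (p - sin p cos p) / (4 p\<^sup>2)\<close>: no circular arc of unit length and half-angle \<open>p\<close>
  ends strictly inside the inner ellipsoid. There is equality for the full circle \<open>p = pi\<close>,
  whence the constant \<open>16 pi\<^sup>2\<close>, but for \<open>p \<ge> pi/2\<close> the sign of the cosine alone gives the
  claim. For smaller \<open>p\<close> the factor \<open>p\<^sup>2 - sin\<^sup>2 p\<close> is at most \<open>2 p (p - sin p)\<close>, hence at most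
  \<open>2 p (p - sin p cos p)\<close>, and the cubic lower bound above settles it.
\<close>

lemma arc_profile_inequality:
  fixes p :: real
  assumes "0 \<le> p" "p \<le> pi"
  shows "p\<^sup>2 * (p\<^sup>2 - (sin p)\<^sup>2) \<le> pi\<^sup>2 * (p - sin p * cos p)\<^sup>2"
proof (cases "p \<le> pi / 2")
  case True
  have s: "0 \<le> sin p" "sin p \<le> p" and c: "cos p \<le> 1"
    using assms by (auto intro: sin_ge_zero sin_x_le_x)
  have sc: "p - sin p \<le> p - sin p * cos p"
    using s c by (simp add: mult_left_le)
  have "p\<^sup>2 * (p\<^sup>2 - (sin p)\<^sup>2) = p\<^sup>2 * (p - sin p) * (p + sin p)"
    by (simp add: power2_eq_square algebra_simps)
  also have "\<dots> \<le> p\<^sup>2 * (p - sin p) * (2 * p)"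
    using s by (intro mult_left_mono mult_nonneg_nonneg) auto
  also have "\<dots> = 2 * p ^ 3 * (p - sin p)"
    by (simp add: power2_eq_square power3_eq_cube)
  also have "\<dots> \<le> pi\<^sup>2 * (p - sin p * cos p) * (p - sin p * cos p)"
    using assms True s sc by (intro mult_mono cube_le_self_minus_sin_cos) auto
  finally show ?thesis by (simp add: power2_eq_square mult.assoc)
next
  case False
  have "sin p * cos p \<le> 0"
    using assms False cos_monotone_0_pi_le[of "pi / 2" p]
    by (intro mult_nonneg_nonpos sin_ge_zero) auto
  have "p\<^sup>2 * (p\<^sup>2 - (sin p)\<^sup>2) \<le> p\<^sup>2 * p\<^sup>2"
    by (intro mult_left_mono) auto
  also have "\<dots> \<le> pi\<^sup>2 * (p - sin p * cos p)\<^sup>2"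
    using assms \<open>sin p * cos p \<le> 0\<close> by (intro mult_mono power_mono) auto
  finally show ?thesis .
qed

text \<open>
  A circular arc with half-angle \<open>p\<close> and length \<open>l\<close> has squared chord \<open>r = (l sin p / p)\<^sup>2\<close> and
  encloses with its chord the area \<open>z = l\<^sup>2 (p - sin p cos p) / (4 p\<^sup>2)\<close>. The equation here
  prescribes the ratio of the two, leaving \<open>l\<close> as a free scale. It always has a solution by the
  intermediate value theorem: \<open>p - sin p cos p \<le> p sin\<^sup>2 p\<close> gives the sign of the difference of
  the two sides for small \<open>p\<close>, and at \<open>p = pi\<close> the left-hand side vanishes.
\<close>

lemma arc_half_angle_exists:
  fixes r z :: real
  assumes "0 < z" "0 \<le> r"
  shows "\<exists>p. 0 < p \<and> p \<le> pi \<and> 4 * z * (sin p)\<^sup>2 = r * (p - sin p * cos p)"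
proof -
  define f where "f p = 4 * z * (sin p)\<^sup>2 - r * (p - sin p * cos p)" for p
  \<comment> \<open>The denominator is \<open>r + 1\<close> instead of \<open>r\<close> so that \<open>r = 0\<close> needs no separate treatment.\<close>
  define p0 where "p0 = min (pi / 2) (4 * z / (r + 1))"
  have r1: "0 < r + 1"
    using assms by simp
  have p0: "0 < p0" "p0 \<le> pi / 2" "r * p0 \<le> 4 * z"
  proof -
    show p0_pos: "0 < p0" "p0 \<le> pi / 2" using assms r1 by (auto simp: p0_def)
    have "p0 \<le> 4 * z / (r + 1)" by (simp add: p0_def)
    then have "r * p0 + p0 \<le> 4 * z"
      using r1 by (simp add: field_simps)
    then show "r * p0 \<le> 4 * z" using p0_pos by linarith
  qed
  have "p0 - sin p0 * cos p0 \<le> p0 * (sin p0)\<^sup>2"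
  proof -
    have "p0 * cos p0 * cos p0 \<le> sin p0 * cos p0"
      using p0 pi_gt_zero by (intro mult_right_mono mult_cos_le_sin cos_ge_zero) linarith+
    moreover have "p0 * cos p0 * cos p0 + p0 * (sin p0)\<^sup>2 = p0"
      by (simp add: power2_eq_square mult.assoc flip: distrib_left)
    ultimately show ?thesis by linarith
  qed
  then have "r * (p0 - sin p0 * cos p0) \<le> r * (p0 * (sin p0)\<^sup>2)"
    using assms by (intro mult_left_mono) auto
  also have "\<dots> = (r * p0) * (sin p0)\<^sup>2" by simp
  also have "\<dots> \<le> 4 * z * (sin p0)\<^sup>2"
    using p0 by (intro mult_right_mono) auto
  finally have "0 \<le> f p0" by (simp add: f_def)
  moreover have "f pi \<le> 0" using assms by (simp add: f_def)
  moreover have "continuous_on {p0..pi} f"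
    unfolding f_def by (intro continuous_intros)
  ultimately obtain p where "p0 \<le> p" "p \<le> pi" "f p = 0"
    using IVT2'[of f pi 0 p0] p0 pi_gt_zero by force
  then show ?thesis using p0 by (intro exI[of _ p]) (auto simp: f_def)
qed

section \<open>Circular arcs and the inner ellipsoid\<close>

lemma smooth_horizontal_curve:
  assumes "0 \<le> T"
    and deriv: "\<And>t. (\<gamma> has_vector_derivative (u1 t *\<^sub>R heis_X1 (\<gamma> t) + u2 t *\<^sub>R heis_X2 (\<gamma> t))) (at t)"
    and cont: "continuous_on UNIV u1" "continuous_on UNIV u2"
  shows "horizontal_curve T \<gamma> u1 u2"
proof -
  let ?D = "\<lambda>t. u1 t *\<^sub>R heis_X1 (\<gamma> t) + u2 t *\<^sub>R heis_X2 (\<gamma> t)"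
  have "continuous_on UNIV \<gamma>"
    using deriv by (intro continuous_at_imp_continuous_on) (auto intro: has_vector_derivative_continuous)
  then have "continuous_on {0..T} ?D"
    unfolding heis_X1_def heis_X2_def case_prod_beta
    by (intro continuous_intros continuous_on_subset[OF cont(1)] continuous_on_subset[OF cont(2)]) (auto intro: continuous_on_subset)
  then have "bounded (?D ` {0..T})"
    by (intro compact_imp_bounded compact_continuous_image) auto
  then obtain L where L: "0 < L" "\<And>t. t \<in> {0..T} \<Longrightarrow> norm (?D t) \<le> L"
    unfolding bounded_pos by force
  have "L-lipschitz_on {0..T} \<gamma>"
  proof (rule lipschitz_onI)
    fix a b assume "a \<in> {0..T}" "b \<in> {0..T}"
    then have "norm (\<gamma> a - \<gamma> b) \<le> L * norm (a - b)"
      using L deriv[unfolded has_vector_derivative_def]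
      by (intro differentiable_bound[of "{0..T}" _ "\<lambda>t h. h *\<^sub>R ?D t"])
        (auto intro: has_derivative_at_withinI intro!: onorm_le simp: mult.commute[of L] mult_left_mono)
    then show "dist (\<gamma> a) (\<gamma> b) \<le> L * dist a b"
      by (simp add: dist_norm)
  qed (use L in simp)
  moreover have "u1 \<in> borel_measurable (lebesgue_on {0..T})" "u2 \<in> borel_measurable (lebesgue_on {0..T})"
    using cont by (auto intro!: continuous_imp_measurable_on_sets_lebesgue continuous_on_subset[of UNIV])
  ultimately show ?thesis
    unfolding horizontal_curve_def using assms(1) deriv
    by (auto intro: has_vector_derivative_at_within)
qed

lemma heis_dist_le_constant_speed:
  assumes curve: "horizontal_curve 1 \<gamma> u1 u2" and "0 \<le> l"
    and speed: "\<And>t. (u1 t)\<^sup>2 + (u2 t)\<^sup>2 = l\<^sup>2"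
  shows "heis_dist (\<gamma> 0) (\<gamma> 1) \<le> ereal l"
proof -
  have "control_length 1 u1 u2 = l"
    using \<open>0 \<le> l\<close> by (simp add: control_length_def speed measure_restrict_space)
  then show ?thesis
    unfolding heis_dist_def using curve by (intro Inf_lower) blast
qed

lemma heis_dist_segment_le:
  "heis_dist heis_id (x, y, 0) \<le> ereal (sqrt (x\<^sup>2 + y\<^sup>2))"
proof -
  let ?\<gamma> = "\<lambda>t. (x * t, y * t, 0)"
  have "horizontal_curve 1 ?\<gamma> (\<lambda>_. x) (\<lambda>_. y)"
    by (rule smooth_horizontal_curve)
      (auto simp: heis_X1_def heis_X2_def intro!: derivative_eq_intros has_vector_derivative_Pair
        simp flip: has_real_derivative_iff_has_vector_derivative)
  from heis_dist_le_constant_speed[OF this, of "sqrt (x\<^sup>2 + y\<^sup>2)"] show ?thesis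
    by (simp add: heis_id_def)
qed

text \<open>
  Controls of constant norm \<open>l\<close> rotating at angular velocity \<open>w\<close> trace a circular arc in the
  plane, and the third coordinate is the area that it sweeps out.
\<close>

lemma heis_dist_arc_le:
  assumes "0 \<le> l" "w \<noteq> 0"
  shows "heis_dist heis_id
    (l * (sin (w + a) - sin a) / w, l * (cos a - cos (w + a)) / w, l\<^sup>2 * (w - sin w) / (2 * w\<^sup>2)) \<le> ereal l"
proof -
  let ?\<gamma> = "\<lambda>t. (l * (sin (w * t + a) - sin a) / w, l * (cos a - cos (w * t + a)) / w,
    l\<^sup>2 * (w * t - sin (w * t)) / (2 * w\<^sup>2))"
  have "horizontal_curve 1 ?\<gamma> (\<lambda>t. l * cos (w * t + a)) (\<lambda>t. l * sin (w * t + a))"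
  proof (rule smooth_horizontal_curve)
    fix t :: real
    let ?b = "w * t + a"
    have "cos (w * t) = cos ?b * cos a + sin ?b * sin a"
      using cos_diff[of ?b a] by simp
    then have z: "l\<^sup>2 * (w - w * cos (w * t)) / (2 * w\<^sup>2) =
        (l * cos ?b) * (- (l * (cos a - cos ?b) / w) / 2) + (l * sin ?b) * ((l * (sin ?b - sin a) / w) / 2)"
    proof -
      have "1 - cos (w * t) = (sin ?b)\<^sup>2 + (cos ?b)\<^sup>2 - cos (w * t)"
        by simp
      also have "\<dots> = sin ?b * (sin ?b - sin a) - cos ?b * (cos a - cos ?b)"
        unfolding \<open>cos (w * t) = _\<close> by (simp add: power2_eq_square algebra_simps)
      finally have key: "1 - cos (w * t) = sin ?b * (sin ?b - sin a) - cos ?b * (cos a - cos ?b)" .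
      have "l\<^sup>2 * (w - w * cos (w * t)) / (2 * w\<^sup>2) = l\<^sup>2 / (2 * w) * (1 - cos (w * t))"
        using \<open>w \<noteq> 0\<close> by (simp add: field_simps power2_eq_square)
      moreover have "l\<^sup>2 / (2 * w) * (q * (q - q') - p * (p' - p)) =
          (l * p) * (- (l * (p' - p) / w) / 2) + (l * q) * (l * (q - q') / w / 2)" for p p' q q' :: real
        using \<open>w \<noteq> 0\<close> by (simp add: divide_simps power2_eq_square) (simp add: algebra_simps)
      ultimately show ?thesis
        by (simp only: key)
    qed
    have "(?\<gamma> has_vector_derivative
        (l * cos ?b, l * sin ?b, l\<^sup>2 * (w - w * cos (w * t)) / (2 * w\<^sup>2))) (at t)"
      using \<open>w \<noteq> 0\<close>
      by (auto intro!: derivative_eq_intros has_vector_derivative_Pair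
          simp flip: has_real_derivative_iff_has_vector_derivative)
    then show "(?\<gamma> has_vector_derivative
        ((l * cos ?b) *\<^sub>R heis_X1 (?\<gamma> t) + (l * sin ?b) *\<^sub>R heis_X2 (?\<gamma> t))) (at t)"
      by (simp only: z heis_X1_def heis_X2_def prod.case scaleR_Pair add_Pair real_scaleR_def
          mult_1_right mult_zero_right add_0_right add_0_left)
  qed (auto intro!: continuous_intros)
  from heis_dist_le_constant_speed[OF this \<open>0 \<le> l\<close>] show ?thesis
    by (simp add: heis_id_def power_mult_distrib flip: distrib_left)
qed

text \<open>
  The same arc described by its half-angle \<open>h\<close> and the direction \<open>b\<close> of its chord, which is the
  direction of the velocity at half time.
\<close>

lemma heis_dist_symmetric_arc_le:
  assumes "0 \<le> l" "h \<noteq> 0"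
  shows "heis_dist heis_id
    (l * sin h / h * cos b, l * sin h / h * sin b, l\<^sup>2 * (h - sin h * cos h) / (4 * h\<^sup>2)) \<le> ereal l"
proof -
  have "sin (2 * h + (b - h)) - sin (b - h) = 2 * (sin h * cos b)"
    "cos (b - h) - cos (2 * h + (b - h)) = 2 * (sin h * sin b)"
    using sin_add[of b h] sin_diff[of b h] cos_add[of b h] cos_diff[of b h]
    by (simp_all add: algebra_simps)
  then have "l * (sin (2 * h + (b - h)) - sin (b - h)) / (2 * h) = l * sin h / h * cos b"
    "l * (cos (b - h) - cos (2 * h + (b - h))) / (2 * h) = l * sin h / h * sin b"
    by simp_all
  moreover have "l\<^sup>2 * (2 * h - sin (2 * h)) / (2 * (2 * h)\<^sup>2) = l\<^sup>2 * (h - sin h * cos h) / (4 * h\<^sup>2)"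
    by (simp add: sin_double power_mult_distrib divide_simps)
  ultimately show ?thesis
    using heis_dist_arc_le[of l "2 * h" "b - h"] assms by simp
qed

text \<open>
  Off the plane \<open>z = 0\<close> the point is the end of a circular arc, whose half-angle comes from the
  ratio of \<open>z\<close> to \<open>x\<^sup>2 + y\<^sup>2\<close> and whose length \<open>l\<close> is then determined. If \<open>l\<close> exceeded \<open>R\<close>, then
  scaling down to unit length would place the end of a unit arc strictly inside the inner
  ellipsoid, against the profile inequality.
\<close>

lemma heis_dist_le_of_ellipsoid:
  assumes "0 < R" and E: "R\<^sup>2 * (x\<^sup>2 + y\<^sup>2) + 16 * pi\<^sup>2 * z\<^sup>2 \<le> R ^ 4"
  shows "heis_dist heis_id (x, y, z) \<le> ereal R"
proof (cases "z = 0")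
  case True
  have "R\<^sup>2 * (x\<^sup>2 + y\<^sup>2) \<le> R\<^sup>2 * R\<^sup>2"
    using E True by (simp add: eval_nat_numeral)
  then have "x\<^sup>2 + y\<^sup>2 \<le> R\<^sup>2"
    using \<open>0 < R\<close> by (simp only: mult_le_cancel_left_pos zero_less_power)
  then have "sqrt (x\<^sup>2 + y\<^sup>2) \<le> R"
    using \<open>0 < R\<close> by (simp add: real_le_lsqrt)
  then show ?thesis
    using heis_dist_segment_le[of x y] True by (auto intro: order_trans)
next
  case False
  define r where "r = x\<^sup>2 + y\<^sup>2"
  have "0 \<le> r" by (simp add: r_def)
  obtain p where p: "0 < p" "p \<le> pi" and slope: "4 * \<bar>z\<bar> * (sin p)\<^sup>2 = r * (p - sin p * cos p)"
    using arc_half_angle_exists[of "\<bar>z\<bar>" r] False \<open>0 \<le> r\<close> by auto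
  define v where "v = p - sin p * cos p"
  have s: "0 \<le> sin p" "sin p \<le> p"
    using p by (auto intro: sin_ge_zero sin_x_le_x)
  have "0 < v"
  proof -
    have "sin p * cos p \<le> p"
      using s mult_left_le[of "cos p" "sin p"] by simp
    moreover have "v \<noteq> 0"
    proof
      assume "v = 0"
      then have "sin p = 0"
        using slope False by (simp add: v_def)
      then show False
        using \<open>v = 0\<close> p by (simp add: v_def)
    qed
    ultimately show ?thesis by (simp add: v_def)
  qed
  \<comment> \<open>The length for which the arc of half-angle \<open>p\<close> encloses the area \<open>\<bar>z\<bar>\<close>.\<close>
  define l where "l = 2 * p * sqrt (\<bar>z\<bar> / v)"
  have "0 \<le> l" using p \<open>0 < v\<close> by (simp add: l_def)
  have l: "l\<^sup>2 * v = 4 * p\<^sup>2 * \<bar>z\<bar>"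
    using \<open>0 < v\<close> by (simp add: l_def power_mult_distrib)
  have "r * p\<^sup>2 * v = p\<^sup>2 * (4 * \<bar>z\<bar> * (sin p)\<^sup>2)"
    by (simp add: slope v_def)
  also have "\<dots> = (l\<^sup>2 * v) * (sin p)\<^sup>2"
    by (simp add: l)
  finally have "r * p\<^sup>2 * v = l\<^sup>2 * (sin p)\<^sup>2 * v"
    by (simp only: ac_simps)
  then have r: "r * p\<^sup>2 = l\<^sup>2 * (sin p)\<^sup>2"
    using \<open>0 < v\<close> by simp
  have "l \<le> R"
  proof (rule ccontr)
    assume "\<not> l \<le> R"
    then have "R\<^sup>2 < l\<^sup>2"
      using \<open>0 < R\<close> by (intro power_strict_mono) auto
    have profile: "p\<^sup>2 * (p\<^sup>2 - (sin p)\<^sup>2) \<le> pi\<^sup>2 * v\<^sup>2"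
      unfolding v_def using p by (intro arc_profile_inequality) auto
    have sp: "(sin p)\<^sup>2 \<le> p\<^sup>2"
      using s by (intro power_mono)
    have "R\<^sup>2 * (l\<^sup>2 * p ^ 4) = R\<^sup>2 * (l\<^sup>2 * (sin p)\<^sup>2) * p\<^sup>2 + R\<^sup>2 * (l\<^sup>2 * (p\<^sup>2 * (p\<^sup>2 - (sin p)\<^sup>2)))"
      by (simp add: algebra_simps eval_nat_numeral)
    also have "\<dots> \<le> R\<^sup>2 * (l\<^sup>2 * (sin p)\<^sup>2) * p\<^sup>2 + l\<^sup>2 * (l\<^sup>2 * (pi\<^sup>2 * v\<^sup>2))"
      using \<open>R\<^sup>2 < l\<^sup>2\<close> sp
      by (intro add_left_mono mult_mono[OF _ mult_left_mono[OF profile]]) simp_all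
    also have "\<dots> = R\<^sup>2 * (r * p\<^sup>2) * p\<^sup>2 + pi\<^sup>2 * (l\<^sup>2 * v)\<^sup>2"
      unfolding r by (simp add: power2_eq_square mult.assoc mult.left_commute)
    also have "\<dots> = (R\<^sup>2 * r + 16 * pi\<^sup>2 * z\<^sup>2) * p ^ 4"
      unfolding l by (simp add: power_mult_distrib algebra_simps eval_nat_numeral)
    also have "\<dots> \<le> R ^ 4 * p ^ 4"
      using E by (intro mult_right_mono) (auto simp: r_def)
    finally have "R\<^sup>2 * p ^ 4 * l\<^sup>2 \<le> R\<^sup>2 * p ^ 4 * R\<^sup>2"
      by (simp add: algebra_simps eval_nat_numeral)
    then have "l\<^sup>2 \<le> R\<^sup>2"
      using \<open>0 < R\<close> p by simp
    then show False using \<open>R\<^sup>2 < l\<^sup>2\<close> by simp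
  qed
  \<comment> \<open>The sign of \<open>z\<close> decides whether the arc turns left or right.\<close>
  define h where "h = sgn z * p"
  have h: "h \<noteq> 0" "sin h / h = sin p / p" "h - sin h * cos h = sgn z * v" "h\<^sup>2 = p\<^sup>2"
    using False p by (auto simp: h_def v_def sgn_if)
  define b where "b = Arg (Complex x y)"
  have "(l * sin p / p)\<^sup>2 = r"
    using r p by (simp add: power_divide power_mult_distrib divide_eq_eq)
  then have "l * sin p / p = sqrt r"
    using \<open>0 \<le> l\<close> s p by (intro real_sqrt_unique[symmetric]) auto
  then have chord: "l * sin h / h = cmod (Complex x y)"
    using h(2) by (simp add: r_def cmod_def flip: times_divide_eq_right)
  have polar: "cmod (Complex x y) * cos b = x" "cmod (Complex x y) * sin b = y"
    using rcis_cmod_Arg[of "Complex x y"] unfolding b_def by (metis Re_rcis Im_rcis complex.sel)+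
  have "l\<^sup>2 * (h - sin h * cos h) / (4 * h\<^sup>2) = sgn z * (l\<^sup>2 * v) / (4 * p\<^sup>2)"
    by (simp add: h)
  also have "\<dots> = z"
    using p by (simp add: l mult_sgn_abs)
  finally have "heis_dist heis_id (x, y, z) \<le> ereal l"
    using heis_dist_symmetric_arc_le[OF \<open>0 \<le> l\<close> h(1), of b] by (simp add: chord polar)
  also have "\<dots> \<le> ereal R" using \<open>l \<le> R\<close> by simp
  finally show ?thesis .
qed

lemma dilation_E1_subset_heis_ball:
  assumes "R > 0"
  shows "heis_dilation R ` E1 \<subseteq> heis_ball R"
proof clarsimp
  fix x y z assume "(x, y, z) \<in> E1"
  then have "R ^ 4 * (x\<^sup>2 + y\<^sup>2 + 16 * pi\<^sup>2 * z\<^sup>2) \<le> R ^ 4 * 1"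
    using assms by (intro mult_left_mono) (auto simp: E1_def)
  then have "R\<^sup>2 * ((R * x)\<^sup>2 + (R * y)\<^sup>2) + 16 * pi\<^sup>2 * (R\<^sup>2 * z)\<^sup>2 \<le> R ^ 4"
    by (simp add: algebra_simps eval_nat_numeral)
  then show "heis_dilation R (x, y, z) \<in> heis_ball R"
    using assms by (auto simp: heis_ball_def heis_dilation_def intro!: heis_dist_le_of_ellipsoid)
qed

theorem corollary8p5:
  fixes R :: real
  assumes "R > 0"
  shows "heis_dilation R ` E1 \<subseteq> heis_ball R \<and> heis_ball R \<subseteq> heis_dilation R ` E2"
  using dilation_E1_subset_heis_ball[OF assms] heis_ball_subset_dilation_E2[OF assms] by blast

end
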